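(* Let $R$ be a nontrivial commutative ring with identity which is not an integral domain. Then: (1) $\mathrm{diam}(\Gamma(R[X]))=1$ if and only if $Z(R)^2=(0)$. (2) $\mathrm{diam}(\Gamma(R[X]))=2$ if and only if either $R$ is (up to isomorphism) a subring of a product of two integral domains, or ($R$ is a McCoy ring and $Z(R)$ is an ideal of $R$ such that $Z(R)^2\neq(0)$). (3) $\mathrm{diam}(\Gamma(R[X]))=3$ if and only if ($R$ is not a McCoy ring or $Z(R)$ is not an ideal of $R$) and $R$ is not (up to isomorphism) a subring of a product of two integral domains.
   Context: For a commutative ring $A$, $Z(A)$ is the set of zero-divisors of $A$ (including $0$) and $Z(A)^{\star}=Z(A)\setminus\{0\}$. $Z(A)^2=(0)$ means $xy=0$ for all $x,y\in Z(A)$. A commutative ring $A$ is a McCoy ring if each finitely generated ideal of $A$ contained in $Z(A)$ has a nonzero annihilator. $R[X]$ is the polynomial ring in one variable. The zero-divisor graph $\Gamma(A)$ is the undirected simple graph with vertex set $Z(A)^{\star}$ in which distinct $x,y$ are adjacent if and only if $xy=0$. The distance between two vertices is the least length (number of edges) of a path joining them ($\infty$ if there is none), and the diameter $\mathrm{diam}(\Gamma(A))$ is the greatest distance between two vertices. *)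

theory Defs
  imports "HOL-Algebra.Algebra" "Graph_Theory.Graph_Theory"
begin

definition zero_divisors :: "('a, 'm) ring_scheme \<Rightarrow> 'a set" where
  "zero_divisors A =
     {x \<in> carrier A. \<exists>y \<in> carrier A. y \<noteq> \<zero>\<^bsub>A\<^esub> \<and> x \<otimes>\<^bsub>A\<^esub> y = \<zero>\<^bsub>A\<^esub>}"

lemma (in ring) zero_mem_zero_divisors:
  assumes "\<one> \<noteq> \<zero>"
  shows "\<zero> \<in> zero_divisors R"
  using assms by (auto simp: zero_divisors_def)

definition zero_divisors_square_zero :: "('a, 'm) ring_scheme \<Rightarrow> bool" where
  "zero_divisors_square_zero A \<longleftrightarrow>
     (\<forall>x \<in> zero_divisors A. \<forall>y \<in> zero_divisors A. x \<otimes>\<^bsub>A\<^esub> y = \<zero>\<^bsub>A\<^esub>)"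

definition mccoy_ring :: "('a, 'm) ring_scheme \<Rightarrow> bool" where
  "mccoy_ring A \<longleftrightarrow> cring A \<and>
     (\<forall>I. ideal I A \<and> (\<exists>S \<subseteq> carrier A. finite S \<and> I = Idl\<^bsub>A\<^esub> S) \<and> I \<subseteq> zero_divisors A \<longrightarrow>
        (\<exists>r \<in> carrier A. r \<noteq> \<zero>\<^bsub>A\<^esub> \<and> (\<forall>x \<in> I. r \<otimes>\<^bsub>A\<^esub> x = \<zero>\<^bsub>A\<^esub>)))"

text \<open>An undirected simple graph is encoded, as usual in this library, as a symmetric
  loop-free digraph: each edge is represented by its two orientations.\<close>

definition zero_divisor_graph :: "('a, 'm) ring_scheme \<Rightarrow> 'a pair_pre_digraph" where
  "zero_divisor_graph A =
     \<lparr> pverts = zero_divisors A - {\<zero>\<^bsub>A\<^esub>},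
       parcs = {(x, y). x \<in> zero_divisors A - {\<zero>\<^bsub>A\<^esub>} \<and> y \<in> zero_divisors A - {\<zero>\<^bsub>A\<^esub>} \<and>
                        x \<noteq> y \<and> x \<otimes>\<^bsub>A\<^esub> y = \<zero>\<^bsub>A\<^esub>} \<rparr>"

lemma (in cring) zero_divisor_graph_bidirected:
  "pair_bidirected_digraph (zero_divisor_graph R)"
proof unfold_locales
  show "symmetric (with_proj (zero_divisor_graph R))"
    unfolding symmetric_def with_proj_simps
  proof (rule symI)
    fix x y assume "(x, y) \<in> parcs (zero_divisor_graph R)"
    moreover from this have "x \<in> carrier R" "y \<in> carrier R"
      by (simp_all add: zero_divisor_graph_def zero_divisors_def)
    ultimately show "(y, x) \<in> parcs (zero_divisor_graph R)"
      by (auto simp: zero_divisor_graph_def m_comm)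
  qed
qed (simp_all add: zero_divisor_graph_def split_beta)

text \<open>A path is a list of arcs visiting pairwise distinct vertices.  The infimum over the
  empty set is infinity.\<close>

definition graph_distance :: "('a, 'b) pre_digraph \<Rightarrow> 'a \<Rightarrow> 'a \<Rightarrow> enat" where
  "graph_distance G u v = (INF p \<in> {p. pre_digraph.apath G u p v}. enat (length p))"

definition graph_diameter :: "('a, 'b) pre_digraph \<Rightarrow> enat" where
  "graph_diameter G = (SUP u \<in> verts G. SUP v \<in> verts G. graph_distance G u v)"

text \<open>Subrings contain the identity of the ambient ring.
  HOL cannot quantify over types inside a formula, so the two integral domains are taken
  on the type \<open>'a set\<close>, which suffices for all quotients of \<open>A\<close>.  The lemma
  \<open>subring_of_product_of_two_domains_any_type\<close> below shows that this is no restriction: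
  domains on arbitrary types can be replaced by the quotients of \<open>A\<close> modulo
  the kernels of the two projections.\<close>

definition subring_of_product_of_two_domains :: "('a, 'm) ring_scheme \<Rightarrow> bool" where
  "subring_of_product_of_two_domains A \<longleftrightarrow>
     (\<exists>(D1 :: 'a set ring) (D2 :: 'a set ring) S.
        domain D1 \<and> domain D2 \<and> subring S (RDirProd D1 D2) \<and>
        A \<simeq> (RDirProd D1 D2)\<lparr>carrier := S\<rparr>)"

lemma (in cring) quotient_by_kernel_into_domain:
  assumes D: "domain D" and f: "f \<in> ring_hom R D"
  shows "ideal (a_kernel R D f) R" and "domain (R Quot a_kernel R D f)"
proof -
  interpret D: domain D by (rule D)
  interpret f: ring_hom_ring R D f
    by (rule ring_hom_ringI2[OF ring_axioms D.ring_axioms f])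
  show "ideal (a_kernel R D f) R" by (rule f.kernel_is_ideal)
  have "primeideal {\<zero>\<^bsub>D\<^esub>} D" by (rule D.zeroprimeideal)
  then have "primeideal {r \<in> carrier R. f r \<in> {\<zero>\<^bsub>D\<^esub>}} R"
    by (rule f.primeideal_vimage[OF is_cring])
  then have "primeideal (a_kernel R D f) R" unfolding a_kernel_def' by simp
  then show "domain (R Quot a_kernel R D f)" by (rule primeideal.quotient_is_domain)
qed

lemma subring_of_product_of_two_domains_any_type:
  fixes A :: "('a, 'm) ring_scheme"
    and D1 :: "('b, 'n) ring_scheme" and D2 :: "('c, 'k) ring_scheme"
  assumes A: "cring A" and D1: "domain D1" and D2: "domain D2"
    and S: "subring S (RDirProd D1 D2)" and iso: "A \<simeq> (RDirProd D1 D2)\<lparr>carrier := S\<rparr>"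
  shows "subring_of_product_of_two_domains A"
proof -
  interpret A: cring A by (rule A)
  obtain h where h: "h \<in> ring_hom A ((RDirProd D1 D2)\<lparr>carrier := S\<rparr>)"
    and inj: "inj_on h (carrier A)"
    using iso by (auto simp: is_ring_iso_def ring_iso_def bij_betw_def)
  have S_sub: "S \<subseteq> carrier (RDirProd D1 D2)"
    by (rule subringE(1)[OF S])
  have P_simps: "carrier (RDirProd D1 D2) = carrier D1 \<times> carrier D2"
    "x \<otimes>\<^bsub>RDirProd D1 D2\<^esub> y = (fst x \<otimes>\<^bsub>D1\<^esub> fst y, snd x \<otimes>\<^bsub>D2\<^esub> snd y)"
    "x \<oplus>\<^bsub>RDirProd D1 D2\<^esub> y = (fst x \<oplus>\<^bsub>D1\<^esub> fst y, snd x \<oplus>\<^bsub>D2\<^esub> snd y)"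
    "\<one>\<^bsub>RDirProd D1 D2\<^esub> = (\<one>\<^bsub>D1\<^esub>, \<one>\<^bsub>D2\<^esub>)" for x y
    by (simp_all add: RDirProd_def DirProd_def monoid.defs split_beta)
  have h_in: "h a \<in> carrier D1 \<times> carrier D2" if "a \<in> carrier A" for a
    using ring_hom_closed[OF h that] S_sub by (auto simp: P_simps)
  have f1: "(\<lambda>a. fst (h a)) \<in> ring_hom A D1" and f2: "(\<lambda>a. snd (h a)) \<in> ring_hom A D2"
    using h_in ring_hom_mult[OF h] ring_hom_add[OF h] ring_hom_one[OF h]
    by (intro ring_hom_memI; force simp: P_simps)+
  define I J where "I = a_kernel A D1 (\<lambda>a. fst (h a))" and "J = a_kernel A D2 (\<lambda>a. snd (h a))"
  have I: "ideal I A" "domain (A Quot I)" and J: "ideal J A" "domain (A Quot J)"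
    using A.quotient_by_kernel_into_domain[OF D1 f1] A.quotient_by_kernel_into_domain[OF D2 f2]
    by (simp_all add: I_def J_def)
  interpret D1: domain D1 by (rule D1)
  interpret D2: domain D2 by (rule D2)
  interpret f1: ring_hom_ring A D1 "\<lambda>a. fst (h a)"
    by (rule ring_hom_ringI2[OF A.ring_axioms D1.ring_axioms f1])
  interpret f2: ring_hom_ring A D2 "\<lambda>a. snd (h a)"
    by (rule ring_hom_ringI2[OF A.ring_axioms D2.ring_axioms f2])
  have "I \<inter> J \<subseteq> {\<zero>\<^bsub>A\<^esub>}"
  proof
    fix x assume "x \<in> I \<inter> J"
    then have x: "x \<in> carrier A" "h x = h \<zero>\<^bsub>A\<^esub>"
      unfolding I_def J_def a_kernel_def' by (auto simp: prod_eq_iff)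
    with inj show "x \<in> {\<zero>\<^bsub>A\<^esub>}" by (simp add: inj_on_eq_iff)
  qed
  moreover have "\<zero>\<^bsub>A\<^esub> \<in> I \<inter> J" unfolding I_def J_def a_kernel_def' by simp
  ultimately have IJ: "I \<inter> J = {\<zero>\<^bsub>A\<^esub>}" by blast
  let ?P = "RDirProd (A Quot I) (A Quot J)"
  let ?g = "\<lambda>a. (I +>\<^bsub>A\<^esub> a, J +>\<^bsub>A\<^esub> a)"
  have P: "ring ?P"
    by (intro RDirProd_ring ideal.quotient_is_ring I(1) J(1))
  have g: "?g \<in> ring_hom A ?P"
    using ideal.rcos_ring_hom[OF I(1)] ideal.rcos_ring_hom[OF J(1)]
    by (auto simp: ring_hom_def RDirProd_def DirProd_def monoid.defs)
  interpret g: ring_hom_ring A ?P ?g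
    by (rule ring_hom_ringI2[OF A.ring_axioms P g])
  have "a_kernel A ?P ?g = {\<zero>\<^bsub>A\<^esub>}"
    using A.canonical_proj_ker[OF I(1) J(1)] unfolding IJ .
  then have "inj_on ?g (carrier A)" by (rule g.trivial_ker_imp_inj)
  with g have "?g \<in> ring_iso A (?P\<lparr>carrier := ?g ` carrier A\<rparr>)"
    by (auto simp: ring_iso_def ring_hom_def bij_betw_def)
  then have "A \<simeq> ?P\<lparr>carrier := ?g ` carrier A\<rparr>" by (auto simp: is_ring_iso_def)
  moreover have "subring (?g ` carrier A) ?P"
    by (rule g.img_is_subring[OF A.carrier_is_subring])
  ultimately show ?thesis
    using I(2) J(2) unfolding subring_of_product_of_two_domains_def by blast
qed

end

theory Submission
  imports Defs
begin

text \<open>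
  A zero-divisor graph always has diameter at most \<open>3\<close>, and here at least \<open>1\<close>: since \<open>R\<close> is not a
  domain, a nonzero zero-divisor \<open>x\<close> gives the two vertices \<open>x\<close> and \<open>x X\<close> of the graph of \<open>R[X]\<close>.
  So it suffices to decide when the diameter is at most \<open>1\<close> and when it is at most \<open>2\<close>.  The latter
  means that any two distinct vertices either multiply to zero or have a common nonzero
  annihilator, a condition without any reference to paths.

  McCoy's theorem (\<open>mccoy_constant_annihilator\<close>) transports such conditions between \<open>R[X]\<close> and
  \<open>R\<close>: a polynomial is a zero-divisor iff a single nonzero constant kills all of its coefficients.
  At most \<open>1\<close> therefore amounts to \<open>Z(R)\<^sup>2 = 0\<close>.

  For at most \<open>2\<close>, the main step holds in every commutative ring \<open>T\<close> (\<open>diameter_le_2_cases\<close>).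
  Suppose that zero-divisors \<open>f, g\<close> of \<open>T\<close> have a regular sum.  They have no common nonzero
  annihilator, so a diameter of at most \<open>2\<close> forces \<open>f g = 0\<close>, and testing the diameter on one further pair of
  vertices shows that \<open>ann f\<close> and \<open>ann g\<close> are prime.  These primes meet in zero.  Hence either
  \<open>Z(T)\<close> is closed under addition or \<open>T\<close> has two primes meeting in zero.

  Apply this to \<open>T = R[X]\<close>.  Primes meeting in zero contract to primes of \<open>R\<close> meeting in zero,
  which is the same as an embedding of \<open>R\<close> into a product of two domains.  If instead \<open>Z(R[X])\<close>
  is closed under addition, then so is \<open>Z(R)\<close>, and the generators of a finitely generated ideal
  inside \<open>Z(R)\<close> are coefficients of one polynomial, a sum of monomials in \<open>Z(R[X])\<close>; the constant
  killing that polynomial kills the ideal, so \<open>R\<close> is a McCoy ring.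

  Conversely, if \<open>R\<close> is a McCoy ring and \<open>Z(R)\<close> is an ideal, the coefficients of two zero-divisors
  generate an ideal inside \<open>Z(R)\<close>, and a nonzero constant that annihilates this ideal kills both
  polynomials.  If \<open>R\<close> has primes
  \<open>I, J\<close> with \<open>I \<inter> J = 0\<close>, then every zero-divisor of \<open>R[X]\<close> has its coefficients in \<open>I\<close> or in
  \<open>J\<close>; polynomials on different sides multiply to zero, and those on the same side share an
  annihilating constant.
\<close>

section \<open>The diameter of a zero-divisor graph\<close>

text \<open>Distances are infima in the well-ordered set \<open>enat\<close>, so a finite one is attained by a path.\<close>

lemma graph_distance_le_enat_iff:
  "graph_distance G u v \<le> enat n \<longleftrightarrow> (\<exists>p. pre_digraph.apath G u p v \<and> length p \<le> n)"
proof
  assume le: "graph_distance G u v \<le> enat n"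
  show "\<exists>p. pre_digraph.apath G u p v \<and> length p \<le> n"
  proof (rule ccontr)
    assume "\<not> ?thesis"
    then have "enat (Suc n) \<le> graph_distance G u v"
      unfolding graph_distance_def by (intro INF_greatest) (auto simp: not_le Suc_le_eq)
    also note le
    finally have "enat (Suc n) \<le> enat n" .
    then show False by simp
  qed
next
  assume "\<exists>p. pre_digraph.apath G u p v \<and> length p \<le> n"
  then obtain p where p: "pre_digraph.apath G u p v" "length p \<le> n" by blast
  have "graph_distance G u v \<le> enat (length p)"
    unfolding graph_distance_def by (rule INF_lower) (simp add: p)
  also have "\<dots> \<le> enat n" using p by simp
  finally show "graph_distance G u v \<le> enat n" .
qed

lemma graph_diameter_le_iff:
  "graph_diameter G \<le> d \<longleftrightarrow> (\<forall>u \<in> verts G. \<forall>v \<in> verts G. graph_distance G u v \<le> d)"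
  by (simp add: graph_diameter_def SUP_le_iff)

lemmas apath_simps =
  pre_digraph.apath_def pre_digraph.awalk_def pre_digraph.cas.simps pre_digraph.awalk_verts.simps

context cring
begin

abbreviation vertices :: "'a set" where
  "vertices \<equiv> zero_divisors R - {\<zero>}"

lemma verticesD:
  assumes "u \<in> vertices"
  shows "u \<in> carrier R" "u \<noteq> \<zero>" "\<exists>y \<in> vertices. u \<otimes> y = \<zero>"
proof -
  show u: "u \<in> carrier R" "u \<noteq> \<zero>" using assms by (auto simp: zero_divisors_def)
  obtain y where y: "y \<in> carrier R" "y \<noteq> \<zero>" "u \<otimes> y = \<zero>"
    using assms by (auto simp: zero_divisors_def)
  then have "y \<otimes> u = \<zero>" using u by (simp add: m_comm)
  with u y show "\<exists>y \<in> vertices. u \<otimes> y = \<zero>"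
    by (intro bexI[of _ y]) (auto simp: zero_divisors_def)
qed

lemma exists_nonzero_zero_divisor:
  assumes "\<one> \<noteq> \<zero>" and "\<not> domain R"
  obtains x where "x \<in> zero_divisors R" "x \<noteq> \<zero>"
proof -
  obtain a b where ab: "a \<in> carrier R" "b \<in> carrier R" "a \<otimes> b = \<zero>" "a \<noteq> \<zero>" "b \<noteq> \<zero>"
    using assms is_cring unfolding domain_def domain_axioms_def by blast
  then have "a \<in> zero_divisors R" by (auto simp: zero_divisors_def)
  then show ?thesis using that ab by blast
qed

lemma verticesI:
  "x \<in> carrier R \<Longrightarrow> x \<noteq> \<zero> \<Longrightarrow> y \<in> carrier R \<Longrightarrow> y \<noteq> \<zero> \<Longrightarrow> x \<otimes> y = \<zero> \<Longrightarrow> x \<in> vertices"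
  by (auto simp: zero_divisors_def)

lemma graph_simps:
  "pverts (zero_divisor_graph R) = vertices"
  "(u, v) \<in> parcs (zero_divisor_graph R) \<longleftrightarrow>
     u \<in> vertices \<and> v \<in> vertices \<and> u \<noteq> v \<and> u \<otimes> v = \<zero>"
  by (auto simp: zero_divisor_graph_def)

lemma zero_divisor_graph_distance_le_0_iff:
  assumes "u \<in> vertices"
  shows "graph_distance (with_proj (zero_divisor_graph R)) u v \<le> 0 \<longleftrightarrow> u = v"
  using assms unfolding zero_enat_def graph_distance_le_enat_iff
  by (simp add: apath_simps graph_simps)

lemma zero_divisor_graph_distance_le_1_iff:
  assumes u: "u \<in> vertices" and v: "v \<in> vertices"
  shows "graph_distance (with_proj (zero_divisor_graph R)) u v \<le> 1 \<longleftrightarrow> u = v \<or> u \<otimes> v = \<zero>"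
  unfolding one_enat_def graph_distance_le_enat_iff
proof
  assume "\<exists>p. pre_digraph.apath (with_proj (zero_divisor_graph R)) u p v \<and> length p \<le> 1"
  then obtain p where p: "pre_digraph.apath (with_proj (zero_divisor_graph R)) u p v"
    "length p \<le> 1" by blast
  from p(2) consider "p = []" | e where "p = [e]" by (cases p) auto
  then show "u = v \<or> u \<otimes> v = \<zero>"
    using p(1) by cases (auto simp: apath_simps graph_simps)
next
  assume *: "u = v \<or> u \<otimes> v = \<zero>"
  show "\<exists>p. pre_digraph.apath (with_proj (zero_divisor_graph R)) u p v \<and> length p \<le> 1"
  proof (cases "u = v")
    case True
    then show ?thesis
      using u by (intro exI[of _ "[]"]) (simp add: apath_simps graph_simps)
  next
    case False
    then show ?thesis
      using u v * by (intro exI[of _ "[(u, v)]"]) (simp add: apath_simps graph_simps)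
  qed
qed

lemma zero_divisor_graph_distance_le_2_iff:
  assumes u: "u \<in> vertices" and v: "v \<in> vertices"
  shows "graph_distance (with_proj (zero_divisor_graph R)) u v \<le> 2 \<longleftrightarrow>
    u = v \<or> u \<otimes> v = \<zero> \<or> (\<exists>h \<in> carrier R. h \<noteq> \<zero> \<and> u \<otimes> h = \<zero> \<and> v \<otimes> h = \<zero>)"
    (is "_ \<longleftrightarrow> ?close")
proof
  assume "graph_distance (with_proj (zero_divisor_graph R)) u v \<le> 2"
  then obtain p where p: "pre_digraph.apath (with_proj (zero_divisor_graph R)) u p v"
    "length p \<le> 2"
    unfolding numeral_eq_enat graph_distance_le_enat_iff by blast
  from p(2) consider "p = []" | e where "p = [e]" | e e' where "p = [e, e']"
    by (cases p; cases "tl p") auto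
  then show ?close
  proof cases
    case 3
    then obtain h where "(u, h) \<in> parcs (zero_divisor_graph R)"
        "(h, v) \<in> parcs (zero_divisor_graph R)"
      using p(1) by (cases e; cases e') (auto simp: apath_simps)
    then have "h \<in> vertices" "u \<otimes> h = \<zero>" "h \<otimes> v = \<zero>" by (simp_all add: graph_simps)
    then show ?thesis using verticesD(1,2)[of h] verticesD(1)[OF v] m_comm[of h v] by auto
  qed (use p(1) in \<open>auto simp: apath_simps graph_simps\<close>)
next
  assume close: ?close
  show "graph_distance (with_proj (zero_divisor_graph R)) u v \<le> 2"
  proof (cases "u = v \<or> u \<otimes> v = \<zero>")
    case True
    with zero_divisor_graph_distance_le_1_iff[OF u v] have
      "graph_distance (with_proj (zero_divisor_graph R)) u v \<le> 1" by simp
    then show ?thesis by (rule order_trans) simp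
  next
    case False
    with close obtain h where h: "h \<in> carrier R" "h \<noteq> \<zero>" "u \<otimes> h = \<zero>" "v \<otimes> h = \<zero>" by blast
    then have hv: "h \<otimes> v = \<zero>" "h \<in> vertices"
      using verticesD(1,2)[OF v] verticesI[of h v] by (simp_all add: m_comm)
    \<comment> \<open>As \<open>h\<close> kills both \<open>u\<close> and \<open>v\<close> but they do not kill each other, it is a third vertex.\<close>
    have "h \<noteq> u" "h \<noteq> v" using False h hv by auto
    then have "pre_digraph.apath (with_proj (zero_divisor_graph R)) u [(u, h), (h, v)] v"
      using False u v h hv by (auto simp: apath_simps graph_simps)
    then show ?thesis unfolding numeral_eq_enat graph_distance_le_enat_iff
      by (intro exI[of _ "[(u, h), (h, v)]"]) simp
  qed
qed

lemma zero_divisor_graph_diameter_le_1_iff: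
  "graph_diameter (with_proj (zero_divisor_graph R)) \<le> 1 \<longleftrightarrow>
    (\<forall>u \<in> vertices. \<forall>v \<in> vertices. u = v \<or> u \<otimes> v = \<zero>)"
  unfolding graph_diameter_le_iff
  using zero_divisor_graph_distance_le_1_iff by (simp only: with_proj_simps graph_simps) blast

lemma zero_divisor_graph_diameter_le_2_iff:
  "graph_diameter (with_proj (zero_divisor_graph R)) \<le> 2 \<longleftrightarrow>
    (\<forall>u \<in> vertices. \<forall>v \<in> vertices. u = v \<or> u \<otimes> v = \<zero> \<or>
       (\<exists>h \<in> carrier R. h \<noteq> \<zero> \<and> u \<otimes> h = \<zero> \<and> v \<otimes> h = \<zero>))"
  unfolding graph_diameter_le_iff
  using zero_divisor_graph_distance_le_2_iff by (simp only: with_proj_simps graph_simps) blast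

lemma zero_divisor_graph_diameter_ge_1:
  assumes "u \<in> vertices" "v \<in> vertices" "u \<noteq> v"
  shows "1 \<le> graph_diameter (with_proj (zero_divisor_graph R))"
proof -
  have "\<not> graph_diameter (with_proj (zero_divisor_graph R)) \<le> 0"
    unfolding graph_diameter_le_iff with_proj_simps graph_simps
    using assms zero_divisor_graph_distance_le_0_iff by blast
  then show ?thesis
    using ileI1[of 0 "graph_diameter (with_proj (zero_divisor_graph R))"]
    by (simp add: one_eSuc not_le)
qed

text \<open>If \<open>u\<close> and \<open>v\<close> are at distance more than \<open>2\<close>, they have no common nonzero annihilator.  Take nonzero
  \<open>a\<close> killing \<open>u\<close> and \<open>b\<close> killing \<open>v\<close>.  The product \<open>a \<otimes> b\<close> kills both and so vanishes, which makes \<open>u, a, b, v\<close> a path.\<close>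

lemma zero_divisor_graph_diameter_le_3:
  "graph_diameter (with_proj (zero_divisor_graph R)) \<le> 3"
  unfolding graph_diameter_le_iff with_proj_simps graph_simps
proof (intro ballI)
  fix u v assume u: "u \<in> vertices" and v: "v \<in> vertices"
  show "graph_distance (with_proj (zero_divisor_graph R)) u v \<le> 3"
  proof (cases "graph_distance (with_proj (zero_divisor_graph R)) u v \<le> 2")
    case True
    then show ?thesis by (rule order_trans) simp
  next
    case False
    then have far: "u \<noteq> v" "u \<otimes> v \<noteq> \<zero>"
      and sep: "\<And>h. h \<in> carrier R \<Longrightarrow> u \<otimes> h = \<zero> \<Longrightarrow> v \<otimes> h = \<zero> \<Longrightarrow> h = \<zero>"
      using zero_divisor_graph_distance_le_2_iff[OF u v] by auto
    obtain a b where a: "a \<in> vertices" "u \<otimes> a = \<zero>" and b: "b \<in> vertices" "v \<otimes> b = \<zero>"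
      using verticesD(3)[OF u] verticesD(3)[OF v] by blast
    note carr = verticesD(1)[OF u] verticesD(1)[OF v] verticesD(1)[OF a(1)] verticesD(1)[OF b(1)]
    have nz: "a \<noteq> \<zero>" "b \<noteq> \<zero>" using a b by auto
    have "u \<otimes> (a \<otimes> b) = \<zero>" using a carr by (simp flip: m_assoc)
    moreover have "v \<otimes> (a \<otimes> b) = \<zero>" using b carr by (simp add: m_lcomm)
    ultimately have ab: "a \<otimes> b = \<zero>" using sep carr by simp
    have va: "v \<otimes> a \<noteq> \<zero>" and ub: "u \<otimes> b \<noteq> \<zero>" using sep a b carr nz by blast+
    have vu: "v \<otimes> u \<noteq> \<zero>" and bv: "b \<otimes> v = \<zero>"
      using far b(2) carr m_comm[of v u] m_comm[of b v] by simp_all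
    have "u \<noteq> a" using ab ub by blast
    moreover have "u \<noteq> b" using vu b(2) by blast
    moreover have "a \<noteq> b" using va b(2) by blast
    moreover have "a \<noteq> v" using far a(2) by blast
    moreover have "b \<noteq> v" using va ab bv ub a b far m_comm[of a b] carr by auto
    ultimately have "pre_digraph.apath (with_proj (zero_divisor_graph R)) u [(u, a), (a, b), (b, v)] v"
      using u v a b ab bv far
      by (simp add: apath_simps graph_simps del: Diff_iff)
    then show ?thesis unfolding numeral_eq_enat graph_distance_le_enat_iff
      by (intro exI[of _ "[(u, a), (a, b), (b, v)]"]) simp
  qed
qed

section \<open>Two prime ideals meeting in zero\<close>

text \<open>The intrinsic form of being a subring of a product of two domains, the primes being the kernels
  of the two projections.\<close>

definition two_primes_meeting_in_zero :: bool where
  "two_primes_meeting_in_zero \<longleftrightarrow> (\<exists>I J. primeideal I R \<and> primeideal J R \<and> I \<inter> J = {\<zero>})"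

definition annihilator :: "'a \<Rightarrow> 'a set" where
  "annihilator f = {h \<in> carrier R. f \<otimes> h = \<zero>}"

lemma ideal_annihilator:
  assumes f: "f \<in> carrier R"
  shows "ideal (annihilator f) R"
proof (rule idealI[OF ring_axioms])
  show "subgroup (annihilator f) (add_monoid R)"
    by (rule add.subgroupI)
       (use f in \<open>auto simp: annihilator_def r_distr r_minus simp flip: a_inv_def\<close>)
next
  fix a x assume "a \<in> annihilator f" "x \<in> carrier R"
  then show "x \<otimes> a \<in> annihilator f" "a \<otimes> x \<in> annihilator f"
    using f m_assoc[of f a x] by (auto simp: annihilator_def m_comm[of x a])
qed

text \<open>If \<open>x \<otimes> y\<close> kills \<open>f\<close> but \<open>x\<close> and \<open>y\<close> do not, put \<open>a = f \<otimes> x\<close> and \<open>b = f \<otimes> y\<close>.  Then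
  \<open>b\<close> kills \<open>a \<oplus> g\<close>, so \<open>a \<oplus> g\<close> is a vertex, but it is too far away from \<open>f\<close>: the two have no
  common nonzero annihilator, and \<open>(a \<oplus> g) \<otimes> f = \<zero>\<close> would put the nonzero \<open>a\<close> into both \<open>annihilator f\<close>
  and \<open>annihilator g\<close>.\<close>

lemma annihilator_prime_of_diameter_le_2:
  assumes diam: "graph_diameter (with_proj (zero_divisor_graph R)) \<le> 2"
    and f: "f \<in> vertices" and g: "g \<in> vertices" and fg: "f \<otimes> g = \<zero>"
    and sep: "annihilator f \<inter> annihilator g = {\<zero>}"
  shows "primeideal (annihilator f) R"
proof (rule primeidealI[OF _ is_cring])
  note carr [simp] = verticesD(1)[OF f] verticesD(1)[OF g]
  show "ideal (annihilator f) R" by (rule ideal_annihilator) simp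
  have "\<one> \<notin> annihilator f" using f by (auto simp: annihilator_def)
  then show "carrier R \<noteq> annihilator f" by auto
next
  note carr [simp] = verticesD(1)[OF f] verticesD(1)[OF g]
  fix x y assume xy [simp]: "x \<in> carrier R" "y \<in> carrier R" and "x \<otimes> y \<in> annihilator f"
  then have fxy: "f \<otimes> (x \<otimes> y) = \<zero>" by (simp add: annihilator_def)
  have killed: "h = \<zero>" if "h \<in> carrier R" "f \<otimes> h = \<zero>" "g \<otimes> h = \<zero>" for h
  proof -
    have "h \<in> annihilator f \<inter> annihilator g" using that by (simp add: annihilator_def)
    then show ?thesis unfolding sep by simp
  qed
  show "x \<in> annihilator f \<or> y \<in> annihilator f"
  proof (rule ccontr)
    assume neither: "\<not> (x \<in> annihilator f \<or> y \<in> annihilator f)"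
    define a b where "a = f \<otimes> x" and "b = f \<otimes> y"
    have a: "a \<in> carrier R" "a \<noteq> \<zero>" and b: "b \<in> carrier R" "b \<noteq> \<zero>"
      using neither by (auto simp: a_def b_def annihilator_def)
    have "a \<otimes> b = f \<otimes> (f \<otimes> (x \<otimes> y))" by (simp add: a_def b_def m_ac)
    then have ab: "a \<otimes> b = \<zero>" by (simp add: fxy)
    have gf: "g \<otimes> (f \<otimes> z) = \<zero>" if "z \<in> carrier R" for z
      using fg that m_assoc[of g f z] m_comm[of g f] by simp
    have ga: "g \<otimes> a = \<zero>" and gb: "g \<otimes> b = \<zero>"
      unfolding a_def b_def by (simp_all add: gf)
    define u where "u = a \<oplus> g"
    have u: "u \<in> carrier R" by (simp add: u_def a)
    have ub: "u \<otimes> b = \<zero>" using a b ab gb by (simp add: u_def l_distr)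
    have uf: "h = \<zero>" if h: "h \<in> carrier R" and uh: "u \<otimes> h = \<zero>" and fh: "f \<otimes> h = \<zero>" for h
    proof -
      \<comment> \<open>Since \<open>g\<close> annihilates \<open>a\<close>, multiplying \<open>u \<otimes> h = \<zero>\<close> by \<open>g\<close> leaves \<open>g \<otimes> (g \<otimes> h) = \<zero>\<close>.\<close>
      have "g \<otimes> (u \<otimes> h) = (g \<otimes> a) \<otimes> h \<oplus> g \<otimes> (g \<otimes> h)"
        using h a by (simp add: u_def l_distr r_distr m_assoc)
      then have "g \<otimes> (g \<otimes> h) = \<zero>" using uh ga h by simp
      moreover have "f \<otimes> (g \<otimes> h) = \<zero>" using h fh m_lcomm[of f g h] by simp
      ultimately have "g \<otimes> h = \<zero>" using killed h by simp
      with fh h show "h = \<zero>" using killed by simp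
    qed
    have "u \<noteq> \<zero>" using uf[of g] fg f g by auto
    then have "u \<in> vertices" using verticesI[OF u _ b ub] by simp
    then have "u = f \<or> u \<otimes> f = \<zero> \<or> (\<exists>h \<in> carrier R. h \<noteq> \<zero> \<and> u \<otimes> h = \<zero> \<and> f \<otimes> h = \<zero>)"
      using diam f unfolding zero_divisor_graph_diameter_le_2_iff by blast
    moreover have "u \<noteq> f" using uf[of g] fg g by auto
    moreover have "u \<otimes> f \<noteq> \<zero>"
    proof
      assume "u \<otimes> f = \<zero>"
      then have "f \<otimes> u = \<zero>" using u by (simp add: m_comm[of f u])
      then have "f \<otimes> a = \<zero>" using a fg by (simp add: u_def r_distr)
      then show False using killed ga a by blast
    qed
    ultimately show False using uf by blast
  qed
qed

text \<open>Whatever kills \<open>f\<close> and \<open>g\<close> kills the regular element \<open>f \<oplus> g\<close>, so \<open>f\<close> and \<open>g\<close> are adjacent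
  vertices whose annihilators meet in zero.\<close>

lemma diameter_le_2_cases:
  assumes diam: "graph_diameter (with_proj (zero_divisor_graph R)) \<le> 2"
    and f: "f \<in> zero_divisors R" and g: "g \<in> zero_divisors R"
    and sum: "f \<oplus> g \<notin> zero_divisors R"
  shows "two_primes_meeting_in_zero"
proof -
  have carr [simp]: "f \<in> carrier R" "g \<in> carrier R" using f g by (auto simp: zero_divisors_def)
  have regular: "h = \<zero>" if "h \<in> carrier R" "(f \<oplus> g) \<otimes> h = \<zero>" for h
    using sum that by (auto simp: zero_divisors_def)
  have sep: "h = \<zero>" if "h \<in> carrier R" "f \<otimes> h = \<zero>" "g \<otimes> h = \<zero>" for h
    by (rule regular) (use that in \<open>simp_all add: l_distr\<close>)
  have fv: "f \<in> vertices" and gv: "g \<in> vertices" using f g sum by auto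
  have "f \<noteq> g" using f sep unfolding zero_divisors_def by blast
  then have fg: "f \<otimes> g = \<zero>"
    using diam fv gv sep unfolding zero_divisor_graph_diameter_le_2_iff by blast
  have 1: "annihilator f \<inter> annihilator g = {\<zero>}"
  proof
    show "annihilator f \<inter> annihilator g \<subseteq> {\<zero>}"
      using sep unfolding annihilator_def by blast
  qed (simp add: annihilator_def)
  have "primeideal (annihilator f) R"
    by (rule annihilator_prime_of_diameter_le_2[OF diam fv gv fg 1])
  moreover have "primeideal (annihilator g) R"
    by (rule annihilator_prime_of_diameter_le_2[OF diam gv fv])
       (simp_all add: m_comm[of g f] fg 1 Int_commute[of "annihilator g"])
  ultimately show ?thesis using 1 unfolding two_primes_meeting_in_zero_def by blast
qed

text \<open>Two primes meeting in zero make the ring reduced, so a nonzero zero-divisor has a nonzero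
  square.\<close>

lemma two_primes_not_square_zero:
  assumes "two_primes_meeting_in_zero" and x: "x \<in> zero_divisors R" "x \<noteq> \<zero>"
  shows "\<not> zero_divisors_square_zero R"
proof
  obtain I J where I: "primeideal I R" and J: "primeideal J R" and IJ: "I \<inter> J = {\<zero>}"
    using assms(1) unfolding two_primes_meeting_in_zero_def by blast
  assume "zero_divisors_square_zero R"
  then have xx: "x \<otimes> x = \<zero>" using x by (auto simp: zero_divisors_square_zero_def)
  have xR: "x \<in> carrier R" using x by (auto simp: zero_divisors_def)
  have "\<zero> \<in> I" "\<zero> \<in> J" using IJ by auto
  then have "x \<in> I" "x \<in> J"
    using primeideal.I_prime[OF I xR xR] primeideal.I_prime[OF J xR xR] xx by auto
  then show False using IJ x by blast
qed

lemma subring_of_product_of_two_domains_iff: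
  "subring_of_product_of_two_domains R \<longleftrightarrow> two_primes_meeting_in_zero"
proof
  assume "subring_of_product_of_two_domains R"
  then obtain D1 D2 :: "'a set ring" and S
    where D: "domain D1" "domain D2" and S: "subring S (RDirProd D1 D2)"
      and "R \<simeq> (RDirProd D1 D2)\<lparr>carrier := S\<rparr>"
    unfolding subring_of_product_of_two_domains_def by blast
  then obtain h where h: "h \<in> ring_hom R ((RDirProd D1 D2)\<lparr>carrier := S\<rparr>)"
      and inj: "inj_on h (carrier R)"
    by (auto simp: is_ring_iso_def ring_iso_def bij_betw_def)
  have S_sub: "S \<subseteq> carrier (RDirProd D1 D2)" by (rule subringE(1)[OF S])
  interpret D1: domain D1 by (rule D)
  interpret D2: domain D2 by (rule D)
  have P_simps: "carrier (RDirProd D1 D2) = carrier D1 \<times> carrier D2"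
    "x \<otimes>\<^bsub>RDirProd D1 D2\<^esub> y = (fst x \<otimes>\<^bsub>D1\<^esub> fst y, snd x \<otimes>\<^bsub>D2\<^esub> snd y)"
    "x \<oplus>\<^bsub>RDirProd D1 D2\<^esub> y = (fst x \<oplus>\<^bsub>D1\<^esub> fst y, snd x \<oplus>\<^bsub>D2\<^esub> snd y)"
    "\<one>\<^bsub>RDirProd D1 D2\<^esub> = (\<one>\<^bsub>D1\<^esub>, \<one>\<^bsub>D2\<^esub>)" for x y
    by (simp_all add: RDirProd_def DirProd_def monoid.defs split_beta)
  have h_in: "h a \<in> carrier D1 \<times> carrier D2" if "a \<in> carrier R" for a
    using ring_hom_closed[OF h that] S_sub by (auto simp: P_simps)
  have f1: "fst \<circ> h \<in> ring_hom R D1" and f2: "snd \<circ> h \<in> ring_hom R D2"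
    using h_in ring_hom_mult[OF h] ring_hom_add[OF h] ring_hom_one[OF h]
    by (intro ring_hom_memI; force simp: P_simps)+
  interpret f1: ring_hom_ring R D1 "fst \<circ> h"
    by (rule ring_hom_ringI2[OF ring_axioms D1.ring_axioms f1])
  interpret f2: ring_hom_ring R D2 "snd \<circ> h"
    by (rule ring_hom_ringI2[OF ring_axioms D2.ring_axioms f2])
  define I J where "I = {r \<in> carrier R. (fst \<circ> h) r \<in> {\<zero>\<^bsub>D1\<^esub>}}"
    and "J = {r \<in> carrier R. (snd \<circ> h) r \<in> {\<zero>\<^bsub>D2\<^esub>}}"
  have "primeideal I R" unfolding I_def
    by (rule f1.primeideal_vimage[OF is_cring D1.zeroprimeideal])
  moreover have "primeideal J R" unfolding J_def
    by (rule f2.primeideal_vimage[OF is_cring D2.zeroprimeideal])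
  moreover have "I \<inter> J = {\<zero>}"
  proof
    show "{\<zero>} \<subseteq> I \<inter> J" unfolding I_def J_def using f1.hom_zero f2.hom_zero by auto
    show "I \<inter> J \<subseteq> {\<zero>}"
    proof
      fix x assume "x \<in> I \<inter> J"
      then have x: "x \<in> carrier R" "h x = h \<zero>"
        using f1.hom_zero f2.hom_zero by (auto simp: I_def J_def prod_eq_iff)
      with inj show "x \<in> {\<zero>}" by (simp add: inj_on_eq_iff)
    qed
  qed
  ultimately show "two_primes_meeting_in_zero" unfolding two_primes_meeting_in_zero_def by blast
next
  assume "two_primes_meeting_in_zero"
  then obtain I J where I: "primeideal I R" and J: "primeideal J R" and IJ: "I \<inter> J = {\<zero>}"
    unfolding two_primes_meeting_in_zero_def by blast
  have I': "ideal I R" and J': "ideal J R" using I J by (simp_all add: primeideal.axioms(1))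
  let ?P = "RDirProd (R Quot I) (R Quot J)"
  let ?g = "\<lambda>a. (I +> a, J +> a)"
  have P: "ring ?P"
    by (intro RDirProd_ring ideal.quotient_is_ring I' J')
  have g: "?g \<in> ring_hom R ?P"
    using ideal.rcos_ring_hom[OF I'] ideal.rcos_ring_hom[OF J']
    by (auto simp: ring_hom_def RDirProd_def DirProd_def monoid.defs)
  interpret g: ring_hom_ring R ?P ?g
    by (rule ring_hom_ringI2[OF ring_axioms P g])
  have "a_kernel R ?P ?g = {\<zero>}"
    using canonical_proj_ker[OF I' J'] unfolding IJ .
  then have "inj_on ?g (carrier R)" by (rule g.trivial_ker_imp_inj)
  with g have "?g \<in> ring_iso R (?P\<lparr>carrier := ?g ` carrier R\<rparr>)"
    by (auto simp: ring_iso_def ring_hom_def bij_betw_def)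
  then have "R \<simeq> ?P\<lparr>carrier := ?g ` carrier R\<rparr>" by (auto simp: is_ring_iso_def)
  moreover have "subring (?g ` carrier R) ?P"
    by (rule g.img_is_subring[OF carrier_is_subring])
  ultimately show "subring_of_product_of_two_domains R"
    using primeideal.quotient_is_domain[OF I] primeideal.quotient_is_domain[OF J]
    unfolding subring_of_product_of_two_domains_def by blast
qed

end

section \<open>Zero-divisors of polynomial rings\<close>

lemma (in abelian_monoid) finsum_eq_zero:
  assumes "\<And>i. i \<in> A \<Longrightarrow> h i = \<zero>"
  shows "(\<Oplus>i \<in> A. h i) = \<zero>"
proof -
  have "(\<Oplus>i \<in> A. h i) = (\<Oplus>i \<in> A. \<zero>)"
    by (rule finsum_cong') (use assms in auto)
  then show ?thesis by simp
qed

context UP_cring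
begin

text \<open>Plain names for the coefficient and monomial operations of the polynomial ring; the
  unqualified ones denote operations on coefficient lists in this context.\<close>

abbreviation up_coeff :: "(nat \<Rightarrow> 'a) \<Rightarrow> nat \<Rightarrow> 'a" where
  "up_coeff \<equiv> up_ring.coeff P"

abbreviation up_monom :: "'a \<Rightarrow> nat \<Rightarrow> nat \<Rightarrow> 'a" where
  "up_monom \<equiv> up_ring.monom P"

lemma eq_zero_iff_coeff:
  assumes "p \<in> carrier P"
  shows "p = \<zero>\<^bsub>P\<^esub> \<longleftrightarrow> (\<forall>n. up_coeff p n = \<zero>)"
  using assms by (auto intro: up_eqI)

lemma monom_eq_zero_iff:
  assumes "a \<in> carrier R"
  shows "up_monom a n = \<zero>\<^bsub>P\<^esub> \<longleftrightarrow> a = \<zero>"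
  using assms by (auto simp: eq_zero_iff_coeff)

text \<open>McCoy's theorem.  Let \<open>g\<close> be a nonzero annihilator of \<open>f\<close> of least degree.  If some coefficient of \<open>f\<close>
  does not kill \<open>g\<close>, let \<open>f\<^sub>r\<close> be the last such one; it kills the leading coefficient of \<open>g\<close>, so
  \<open>f\<^sub>r g\<close> is a nonzero annihilator of \<open>f\<close> of smaller degree.  Hence all coefficients of \<open>f\<close> kill
  \<open>g\<close>, and the leading coefficient of \<open>g\<close> is the required constant.\<close>

lemma mccoy_constant_annihilator:
  assumes f: "f \<in> carrier P" and g: "g \<in> carrier P" "g \<noteq> \<zero>\<^bsub>P\<^esub>" "f \<otimes>\<^bsub>P\<^esub> g = \<zero>\<^bsub>P\<^esub>"
  shows "\<exists>c \<in> carrier R. c \<noteq> \<zero> \<and> (\<forall>n. c \<otimes> up_coeff f n = \<zero>)"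
  using g
proof (induction "deg R g" arbitrary: g rule: less_induct)
  case less
  define m where "m = deg R g"
  note gP [simp] = less.prems(1)
  note fP [simp] = f
  have lead: "up_coeff g m \<noteq> \<zero>" unfolding m_def by (rule lcoeff_nonzero) (use less.prems in auto)
  show ?case
  proof (cases "\<forall>i. up_coeff f i \<odot>\<^bsub>P\<^esub> g = \<zero>\<^bsub>P\<^esub>")
    case True
    have "up_coeff g m \<otimes> up_coeff f i = \<zero>" for i
    proof -
      have "up_coeff f i \<otimes> up_coeff g m = up_coeff (up_coeff f i \<odot>\<^bsub>P\<^esub> g) m" by simp
      also have "\<dots> = \<zero>" using True by simp
      finally show ?thesis by (simp add: R.m_comm)
    qed
    with lead show ?thesis by (intro bexI[of _ "up_coeff g m"]) auto
  next
    case False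
    define N where "N = {i. up_coeff f i \<odot>\<^bsub>P\<^esub> g \<noteq> \<zero>\<^bsub>P\<^esub>}"
    have "N \<subseteq> {..deg R f}"
    proof
      fix i assume "i \<in> N"
      then have "up_coeff f i \<noteq> \<zero>" by (auto simp: N_def)
      then show "i \<in> {..deg R f}" using deg_belowI[of i f] by simp
    qed
    then have fin: "finite N" by (rule finite_subset) simp
    define r where "r = Max N"
    have rN: "r \<in> N" unfolding r_def by (rule Max_in) (use fin False in \<open>auto simp: N_def\<close>)
    have above: "up_coeff f i \<otimes> up_coeff g k = \<zero>" if "r < i" for i k
    proof -
      have "i \<notin> N" using that Max_ge[OF fin, of i] by (auto simp: r_def)
      then have "up_coeff f i \<odot>\<^bsub>P\<^esub> g = \<zero>\<^bsub>P\<^esub>" by (simp add: N_def)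
      moreover have "up_coeff f i \<otimes> up_coeff g k = up_coeff (up_coeff f i \<odot>\<^bsub>P\<^esub> g) k" by simp
      ultimately show ?thesis by simp
    qed
    \<comment> \<open>In degree \<open>r + m\<close> every summand of \<open>f \<otimes> g\<close> but one vanishes: those with \<open>i > r\<close> by
      maximality of \<open>r\<close>, those with \<open>i < r\<close> because \<open>g\<close> has degree \<open>m\<close>.\<close>
    have "up_coeff f r \<otimes> up_coeff g m = \<zero>"
    proof -
      have "\<zero> = up_coeff (f \<otimes>\<^bsub>P\<^esub> g) (r + m)" by (simp only: less.prems coeff_zero)
      also have "\<dots> = (\<Oplus>i \<in> {..r + m}. up_coeff f i \<otimes> up_coeff g (r + m - i))" by simp
      also have "\<dots> = (\<Oplus>i \<in> {..r + m}. if r = i then up_coeff f i \<otimes> up_coeff g m else \<zero>)"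
      proof (rule R.finsum_cong')
        fix i assume "i \<in> {..r + m}"
        show "up_coeff f i \<otimes> up_coeff g (r + m - i) =
            (if r = i then up_coeff f i \<otimes> up_coeff g m else \<zero>)"
        proof (cases r i rule: linorder_cases)
          case greater
          then have "up_coeff g (r + m - i) = \<zero>" by (intro deg_aboveD) (auto simp: m_def)
          with greater show ?thesis by simp
        qed (simp_all add: above)
      qed auto
      also have "\<dots> = up_coeff f r \<otimes> up_coeff g m"
        by (rule R.finsum_singleton) auto
      finally show ?thesis by simp
    qed
    define g' where "g' = up_coeff f r \<odot>\<^bsub>P\<^esub> g"
    have g'P: "g' \<in> carrier P" and g'0: "g' \<noteq> \<zero>\<^bsub>P\<^esub>" using rN by (simp_all add: g'_def N_def)
    have "up_coeff g' k = \<zero>" if "m \<le> k" for k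
    proof (cases "k = m")
      case True
      then show ?thesis using \<open>up_coeff f r \<otimes> up_coeff g m = \<zero>\<close> by (simp add: g'_def)
    next
      case False
      with that have "up_coeff g k = \<zero>" by (intro deg_aboveD) (auto simp: m_def)
      then show ?thesis by (simp add: g'_def)
    qed
    moreover have "up_coeff g' (deg R g') \<noteq> \<zero>" by (rule lcoeff_nonzero[OF g'0 g'P])
    ultimately have "deg R g' < deg R g" unfolding m_def[symmetric] by (meson not_le)
    moreover have "f \<otimes>\<^bsub>P\<^esub> g' = \<zero>\<^bsub>P\<^esub>"
    proof -
      have "f \<otimes>\<^bsub>P\<^esub> g' = g' \<otimes>\<^bsub>P\<^esub> f" using g'P by (simp add: P.m_comm)
      also have "\<dots> = up_coeff f r \<odot>\<^bsub>P\<^esub> (g \<otimes>\<^bsub>P\<^esub> f)"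
        unfolding g'_def by (rule UP_smult_assoc2) simp_all
      also have "g \<otimes>\<^bsub>P\<^esub> f = \<zero>\<^bsub>P\<^esub>" using less.prems by (simp add: P.m_comm)
      also have "up_coeff f r \<odot>\<^bsub>P\<^esub> \<zero>\<^bsub>P\<^esub> = \<zero>\<^bsub>P\<^esub>" by (rule up_eqI) simp_all
      finally show ?thesis .
    qed
    ultimately show ?thesis using less.hyps g'P g'0 by blast
  qed
qed

lemma mult_monom_0_eq_zero_iff:
  assumes "f \<in> carrier P" "c \<in> carrier R"
  shows "f \<otimes>\<^bsub>P\<^esub> up_monom c 0 = \<zero>\<^bsub>P\<^esub> \<longleftrightarrow> (\<forall>n. c \<otimes> up_coeff f n = \<zero>)"
proof -
  have "f \<otimes>\<^bsub>P\<^esub> up_monom c 0 = c \<odot>\<^bsub>P\<^esub> f"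
    using assms by (simp add: P.m_comm[of f] monom_mult_is_smult)
  then show ?thesis using assms by (simp add: eq_zero_iff_coeff)
qed

lemma zero_divisors_UP_iff:
  "f \<in> zero_divisors P \<longleftrightarrow>
     f \<in> carrier P \<and> (\<exists>c \<in> carrier R. c \<noteq> \<zero> \<and> (\<forall>n. c \<otimes> up_coeff f n = \<zero>))"
proof
  assume "f \<in> zero_divisors P"
  then show "f \<in> carrier P \<and> (\<exists>c \<in> carrier R. c \<noteq> \<zero> \<and> (\<forall>n. c \<otimes> up_coeff f n = \<zero>))"
    using mccoy_constant_annihilator unfolding zero_divisors_def by blast
next
  assume "f \<in> carrier P \<and> (\<exists>c \<in> carrier R. c \<noteq> \<zero> \<and> (\<forall>n. c \<otimes> up_coeff f n = \<zero>))"
  then obtain c where f: "f \<in> carrier P" and c: "c \<in> carrier R" "c \<noteq> \<zero>"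
    "\<forall>n. c \<otimes> up_coeff f n = \<zero>" by blast
  have "f \<otimes>\<^bsub>P\<^esub> up_monom c 0 = \<zero>\<^bsub>P\<^esub>" using f c by (simp add: mult_monom_0_eq_zero_iff)
  moreover have "up_monom c 0 \<noteq> \<zero>\<^bsub>P\<^esub>" using c by (simp add: monom_eq_zero_iff)
  ultimately show "f \<in> zero_divisors P" using f c(1) unfolding zero_divisors_def by auto
qed

lemma constant_annihilator_of_vertex:
  assumes "u \<in> P.vertices"
  shows "\<exists>c \<in> carrier R. c \<noteq> \<zero> \<and> (\<forall>n. c \<otimes> up_coeff u n = \<zero>)"
  using assms zero_divisors_UP_iff[of u] by simp

lemma monom_mem_zero_divisors_iff:
  assumes x: "x \<in> carrier R"
  shows "up_monom x n \<in> zero_divisors P \<longleftrightarrow> x \<in> zero_divisors R"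
proof
  assume "up_monom x n \<in> zero_divisors P"
  then obtain c where c: "c \<in> carrier R" "c \<noteq> \<zero>" "\<And>i. c \<otimes> up_coeff (up_monom x n) i = \<zero>"
    unfolding zero_divisors_UP_iff by blast
  have "c \<otimes> x = \<zero>" using c(3)[of n] x by simp
  then show "x \<in> zero_divisors R" using c x by (auto simp: zero_divisors_def R.m_comm)
next
  assume "x \<in> zero_divisors R"
  then obtain c where "c \<in> carrier R" "c \<noteq> \<zero>" "x \<otimes> c = \<zero>"
    by (auto simp: zero_divisors_def)
  then show "up_monom x n \<in> zero_divisors P" unfolding zero_divisors_UP_iff
    using x by (auto simp: R.m_comm intro!: bexI[of _ c])
qed

lemma coeff_mem_zero_divisors:
  assumes "f \<in> zero_divisors P"
  shows "up_coeff f n \<in> zero_divisors R"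
  using assms unfolding zero_divisors_UP_iff by (auto simp: zero_divisors_def R.m_comm)

lemma mult_eq_zero_of_coeffs:
  assumes "f \<in> carrier P" "g \<in> carrier P" "\<And>i j. up_coeff f i \<otimes> up_coeff g j = \<zero>"
  shows "f \<otimes>\<^bsub>P\<^esub> g = \<zero>\<^bsub>P\<^esub>"
  using assms by (simp add: eq_zero_iff_coeff R.finsum_eq_zero)

lemma mem_verticesP:
  assumes x: "x \<in> zero_divisors R" "x \<noteq> \<zero>"
  shows "up_monom x n \<in> P.vertices"
  using assms monom_mem_zero_divisors_iff[of x n] monom_eq_zero_iff[of x n]
  by (auto simp: zero_divisors_def)

text \<open>Using a constant and a linear monomial gives two distinct vertices of the graph of \<open>R[X]\<close> even
  when the two coefficients are equal.\<close>

lemma monoms_distinct: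
  assumes "x \<in> carrier R" "y \<in> carrier R" "x \<noteq> \<zero>"
  shows "up_monom x 0 \<noteq> up_monom y 1"
proof
  assume "up_monom x 0 = up_monom y 1"
  then have "up_coeff (up_monom x 0) 0 = up_coeff (up_monom y 1) 0" by simp
  with assms show False by simp
qed

section \<open>The zero-divisor graph of a polynomial ring\<close>

lemma diameter_UP_ge_1:
  assumes "\<one> \<noteq> \<zero>" and "\<not> domain R"
  shows "1 \<le> graph_diameter (with_proj (zero_divisor_graph P))"
proof -
  obtain x where x: "x \<in> zero_divisors R" "x \<noteq> \<zero>"
    using R.exists_nonzero_zero_divisor[OF assms] .
  then have "up_monom x 0 \<noteq> up_monom x 1" by (intro monoms_distinct) (auto simp: zero_divisors_def)
  with mem_verticesP[OF x] show ?thesis by (intro P.zero_divisor_graph_diameter_ge_1)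
qed

lemma diameter_UP_le_1_iff:
  "graph_diameter (with_proj (zero_divisor_graph P)) \<le> 1 \<longleftrightarrow> zero_divisors_square_zero R"
proof
  assume diam: "graph_diameter (with_proj (zero_divisor_graph P)) \<le> 1"
  show "zero_divisors_square_zero R" unfolding zero_divisors_square_zero_def
  proof (intro ballI)
    fix x y assume x: "x \<in> zero_divisors R" and y: "y \<in> zero_divisors R"
    have carr: "x \<in> carrier R" "y \<in> carrier R" using x y by (auto simp: zero_divisors_def)
    show "x \<otimes> y = \<zero>"
    proof (cases "x = \<zero> \<or> y = \<zero>")
      case True
      then show ?thesis using carr by auto
    next
      case False
      then have "up_monom x 0 \<in> P.vertices" "up_monom y 1 \<in> P.vertices" "up_monom x 0 \<noteq> up_monom y 1"
        using mem_verticesP[OF x] mem_verticesP[OF y] monoms_distinct[OF carr] by blast+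
      with diam have "up_monom x 0 \<otimes>\<^bsub>P\<^esub> up_monom y 1 = \<zero>\<^bsub>P\<^esub>"
        unfolding P.zero_divisor_graph_diameter_le_1_iff by blast
      then have "up_monom (x \<otimes> y) (0 + 1) = \<zero>\<^bsub>P\<^esub>" using carr by (simp only: monom_mult)
      then show ?thesis using carr by (simp add: monom_eq_zero_iff del: monom_mult)
    qed
  qed
next
  assume Z: "zero_divisors_square_zero R"
  have "u \<otimes>\<^bsub>P\<^esub> v = \<zero>\<^bsub>P\<^esub>" if "u \<in> zero_divisors P" "v \<in> zero_divisors P" for u v
    using Z that coeff_mem_zero_divisors unfolding zero_divisors_square_zero_def
    by (intro mult_eq_zero_of_coeffs) (auto simp: zero_divisors_UP_iff)
  then show "graph_diameter (with_proj (zero_divisor_graph P)) \<le> 1"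
    unfolding P.zero_divisor_graph_diameter_le_1_iff by blast
qed

text \<open>Primes contract along the embedding of \<open>R\<close> as constants, and injectivity keeps the intersection
  zero.\<close>

lemma two_primes_descend:
  assumes "P.two_primes_meeting_in_zero"
  shows "R.two_primes_meeting_in_zero"
proof -
  let ?c = "\<lambda>a. up_monom a 0"
  obtain I J where IJ: "primeideal I P" "primeideal J P" "I \<inter> J = {\<zero>\<^bsub>P\<^esub>}"
    using assms unfolding P.two_primes_meeting_in_zero_def by blast
  interpret c: ring_hom_ring R P ?c
    by (rule ring_hom_ringI2[OF R.ring_axioms P.ring_axioms])
       (auto simp: ring_hom_def monom_mult[where n = 0 and m = 0, simplified])
  have "primeideal {r \<in> carrier R. ?c r \<in> I} R" "primeideal {r \<in> carrier R. ?c r \<in> J} R"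
    by (rule c.primeideal_vimage[OF R.is_cring IJ(1)], rule c.primeideal_vimage[OF R.is_cring IJ(2)])
  moreover have "{r \<in> carrier R. ?c r \<in> I} \<inter> {r \<in> carrier R. ?c r \<in> J} = {\<zero>}"
  proof -
    have "{r \<in> carrier R. ?c r \<in> I} \<inter> {r \<in> carrier R. ?c r \<in> J} = {r \<in> carrier R. ?c r \<in> I \<inter> J}"
      by blast
    also have "\<dots> = {\<zero>}" unfolding IJ(3) by (auto simp: monom_eq_zero_iff)
    finally show ?thesis .
  qed
  ultimately show ?thesis unfolding R.two_primes_meeting_in_zero_def by blast
qed

text \<open>The annihilating constant of a zero-divisor lies outside one of the two primes, which then
  contains all coefficients.  The local fact \<open>close\<close> treats the case in which this prime is \<open>I\<close> for
  the first polynomial; the other case follows by exchanging \<open>I\<close> and \<open>J\<close>.\<close>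

lemma two_primes_imp_diameter_UP_le_2:
  assumes "R.two_primes_meeting_in_zero"
  shows "graph_diameter (with_proj (zero_divisor_graph P)) \<le> 2"
proof -
  obtain I J where I: "primeideal I R" and J: "primeideal J R" and IJ: "I \<inter> J = {\<zero>}"
    using assms unfolding R.two_primes_meeting_in_zero_def by blast
  have close: "u \<otimes>\<^bsub>P\<^esub> v = \<zero>\<^bsub>P\<^esub> \<or>
      (\<exists>h \<in> carrier P. h \<noteq> \<zero>\<^bsub>P\<^esub> \<and> u \<otimes>\<^bsub>P\<^esub> h = \<zero>\<^bsub>P\<^esub> \<and> v \<otimes>\<^bsub>P\<^esub> h = \<zero>\<^bsub>P\<^esub>)"
    if I: "primeideal I R" and J: "primeideal J R" and IJ: "I \<inter> J = {\<zero>}"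
      and u: "u \<in> P.vertices" and v: "v \<in> P.vertices"
      and c: "c \<in> carrier R" "c \<noteq> \<zero>" "\<And>n. c \<otimes> up_coeff u n = \<zero>" "c \<notin> I"
    for I J u v c
  proof -
    have ideals: "ideal I R" "ideal J R"
      by (rule primeideal.axioms(1)[OF I] primeideal.axioms(1)[OF J])+
    have IJ0: "x = \<zero>" if "x \<in> I" "x \<in> J" for x
    proof -
      have "x \<in> I \<inter> J" using that by simp
      then show ?thesis unfolding IJ by simp
    qed
    have carr [simp]: "u \<in> carrier P" "v \<in> carrier P"
      using P.verticesD(1)[OF u] P.verticesD(1)[OF v] by auto
    have zero: "\<zero> \<in> I" "\<zero> \<in> J"
      by (rule additive_subgroup.zero_closed[OF ideal.axioms(1)[OF ideals(1)]]
            additive_subgroup.zero_closed[OF ideal.axioms(1)[OF ideals(2)]])+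
    have coeffs_in: "up_coeff w n \<in> Q"
      if Q: "primeideal Q R" and "\<zero> \<in> Q" and w: "w \<in> carrier P"
        and e: "e \<in> carrier R" "e \<otimes> up_coeff w n = \<zero>" "e \<notin> Q" for Q w e n
    proof -
      have "e \<otimes> up_coeff w n \<in> Q" unfolding e(2) by fact
      then show ?thesis using primeideal.I_prime[OF Q e(1) coeff_closed[OF w]] e(3) by blast
    qed
    have uI: "up_coeff u n \<in> I" for n by (rule coeffs_in[OF I zero(1) carr(1) c(1,3,4)])
    obtain d where d: "d \<in> carrier R" "d \<noteq> \<zero>" "\<And>n. d \<otimes> up_coeff v n = \<zero>"
      using constant_annihilator_of_vertex[OF v] by metis
    show ?thesis
    proof (cases "d \<in> I")
      case False
      \<comment> \<open>Both polynomials have all coefficients in \<open>I\<close>, and \<open>c\<close> lies in \<open>J\<close> because some coefficient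
        of \<open>u\<close> does not.\<close>
      have vI: "up_coeff v n \<in> I" for n
        by (rule coeffs_in[OF I zero(1) carr(2) d(1,3) False])
      obtain k where k: "up_coeff u k \<noteq> \<zero>"
        using P.verticesD(2)[OF u] eq_zero_iff_coeff[OF carr(1)] by blast
      with uI[of k] have "up_coeff u k \<notin> J" using IJ0 by blast
      then have cJ: "c \<in> J" using coeffs_in[OF J zero(2) carr(1) c(1,3), of k] by blast
      have "c \<otimes> up_coeff v n = \<zero>" for n
        by (rule IJ0[OF ideal.I_l_closed[OF ideals(1) vI c(1)]
              ideal.I_r_closed[OF ideals(2) cJ coeff_closed[OF carr(2)]]])
      then show ?thesis using c
        by (intro disjI2 bexI[of _ "up_monom c 0"])
           (simp_all add: mult_monom_0_eq_zero_iff monom_eq_zero_iff)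
    next
      case True
      then have "d \<notin> J" using d(2) IJ0 by blast
      then have vJ: "up_coeff v n \<in> J" for n by (rule coeffs_in[OF J zero(2) carr(2) d(1,3)])
      have "up_coeff u i \<otimes> up_coeff v j = \<zero>" for i j
        by (rule IJ0[OF ideal.I_r_closed[OF ideals(1) uI coeff_closed[OF carr(2)]]
              ideal.I_l_closed[OF ideals(2) vJ coeff_closed[OF carr(1)]]])
      then show ?thesis by (intro disjI1 mult_eq_zero_of_coeffs) simp_all
    qed
  qed
  show ?thesis unfolding P.zero_divisor_graph_diameter_le_2_iff
  proof (intro ballI, rule disjI2)
    fix u v assume u: "u \<in> P.vertices" and v: "v \<in> P.vertices"
    obtain c where c: "c \<in> carrier R" "c \<noteq> \<zero>" "\<And>n. c \<otimes> up_coeff u n = \<zero>"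
      using constant_annihilator_of_vertex[OF u] by metis
    show "u \<otimes>\<^bsub>P\<^esub> v = \<zero>\<^bsub>P\<^esub> \<or>
      (\<exists>h \<in> carrier P. h \<noteq> \<zero>\<^bsub>P\<^esub> \<and> u \<otimes>\<^bsub>P\<^esub> h = \<zero>\<^bsub>P\<^esub> \<and> v \<otimes>\<^bsub>P\<^esub> h = \<zero>\<^bsub>P\<^esub>)"
    proof (cases "c \<in> I")
      case False
      show ?thesis by (rule close[OF I J IJ u v c False])
    next
      case True
      have cJ: "c \<notin> J"
      proof
        assume "c \<in> J"
        with True have "c \<in> I \<inter> J" by simp
        then show False unfolding IJ using c(2) by simp
      qed
      have JI: "J \<inter> I = {\<zero>}" using IJ by (simp add: Int_commute)
      show ?thesis by (rule close[OF J I JI u v c cJ])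
    qed
  qed
qed

text \<open>The coefficients of two zero-divisors of \<open>R[X]\<close> generate an ideal inside \<open>Z(R)\<close>, so by the McCoy
  property one nonzero constant kills both polynomials.\<close>

lemma mccoy_imp_diameter_UP_le_2:
  assumes M: "mccoy_ring R" and Z: "ideal (zero_divisors R) R"
  shows "graph_diameter (with_proj (zero_divisor_graph P)) \<le> 2"
  unfolding P.zero_divisor_graph_diameter_le_2_iff
proof (intro ballI disjI2)
  fix u v assume u: "u \<in> P.vertices" and v: "v \<in> P.vertices"
  have carr [simp]: "u \<in> carrier P" "v \<in> carrier P"
    using P.verticesD(1)[OF u] P.verticesD(1)[OF v] by auto
  define S where "S = range (up_coeff u) \<union> range (up_coeff v)"
  have "finite (range (up_coeff f))" if f: "f \<in> carrier P" for f
  proof (rule finite_subset)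
    show "range (up_coeff f) \<subseteq> insert \<zero> (up_coeff f ` {..deg R f})"
    proof
      fix x assume "x \<in> range (up_coeff f)"
      then obtain n where "x = up_coeff f n" by blast
      then show "x \<in> insert \<zero> (up_coeff f ` {..deg R f})"
        using deg_aboveD[OF _ f, of n] by (cases "n \<le> deg R f") auto
    qed
  qed simp
  then have fin: "finite S" by (simp add: S_def)
  have SZ: "S \<subseteq> zero_divisors R" using u v by (auto simp: S_def coeff_mem_zero_divisors)
  have SR: "S \<subseteq> carrier R" by (auto simp: S_def)
  have "Idl S \<subseteq> zero_divisors R" by (rule R.genideal_minimal[OF Z SZ])
  then obtain r where r: "r \<in> carrier R" "r \<noteq> \<zero>" "\<forall>x \<in> Idl S. r \<otimes> x = \<zero>"
    using M[unfolded mccoy_ring_def, THEN conjunct2, rule_format, of "Idl S"]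
      SR fin R.genideal_ideal[OF SR] by blast
  have "r \<otimes> x = \<zero>" if "x \<in> S" for x using r(3) R.genideal_self[OF SR] that by blast
  then have "u \<otimes>\<^bsub>P\<^esub> up_monom r 0 = \<zero>\<^bsub>P\<^esub>" "v \<otimes>\<^bsub>P\<^esub> up_monom r 0 = \<zero>\<^bsub>P\<^esub>"
    using r(1) by (simp_all add: mult_monom_0_eq_zero_iff S_def)
  then show "\<exists>h \<in> carrier P. h \<noteq> \<zero>\<^bsub>P\<^esub> \<and> u \<otimes>\<^bsub>P\<^esub> h = \<zero>\<^bsub>P\<^esub> \<and> v \<otimes>\<^bsub>P\<^esub> h = \<zero>\<^bsub>P\<^esub>"
    using r by (intro bexI[of _ "up_monom r 0"]) (simp_all add: monom_eq_zero_iff)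
qed

lemma zero_divisors_ideal_of_sum_closed:
  assumes nt: "\<one> \<noteq> \<zero>"
    and sum: "\<And>f g. f \<in> zero_divisors P \<Longrightarrow> g \<in> zero_divisors P \<Longrightarrow> f \<oplus>\<^bsub>P\<^esub> g \<in> zero_divisors P"
  shows "ideal (zero_divisors R) R"
proof -
  have mult: "a \<otimes> x \<in> zero_divisors R" if a: "a \<in> zero_divisors R" and x: "x \<in> carrier R" for a x
  proof -
    obtain c where c: "c \<in> carrier R" "c \<noteq> \<zero>" "a \<otimes> c = \<zero>" and aR: "a \<in> carrier R"
      using a by (auto simp: zero_divisors_def)
    have "a \<otimes> x \<otimes> c = x \<otimes> (a \<otimes> c)" using aR c(1) x by (simp add: R.m_ac)
    then show ?thesis using c aR x by (auto simp: zero_divisors_def)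
  qed
  have sub: "zero_divisors R \<subseteq> carrier R" by (auto simp: zero_divisors_def)
  show ?thesis
  proof (rule idealI[OF R.ring_axioms])
    show "subgroup (zero_divisors R) (add_monoid R)"
    proof (rule R.add.subgroupI)
      show "zero_divisors R \<subseteq> carrier R" by (rule sub)
      show "zero_divisors R \<noteq> {}" using R.zero_mem_zero_divisors[OF nt] by blast
    next
      fix a assume a: "a \<in> zero_divisors R"
      then have "a \<in> carrier R" using sub by blast
      then have minus: "\<ominus> a = a \<otimes> \<ominus> \<one>" by (simp add: R.r_minus)
      show "\<ominus> a \<in> zero_divisors R" unfolding minus by (rule mult[OF a]) simp
    next
      fix a b assume a: "a \<in> zero_divisors R" and b: "b \<in> zero_divisors R"
      then have carr: "a \<in> carrier R" "b \<in> carrier R" using sub by auto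
      have "up_monom (a \<oplus> b) 0 \<in> zero_divisors P"
        using sum[of "up_monom a 0" "up_monom b 0"] a b carr
        by (simp add: monom_mem_zero_divisors_iff)
      then show "a \<oplus> b \<in> zero_divisors R"
        using carr by (simp add: monom_mem_zero_divisors_iff del: monom_add)
    qed
  next
    fix a x assume "a \<in> zero_divisors R" "x \<in> carrier R"
    then show "a \<otimes> x \<in> zero_divisors R" "x \<otimes> a \<in> zero_divisors R"
      using mult[of a x] sub R.m_comm[of x a] by (simp_all add: subset_iff)
  qed
qed

text \<open>A finite set of zero-divisors can be spread over the coefficients of one polynomial, which is a
  sum of monomials with zero-divisor coefficients and hence a zero-divisor; the constant that kills
  it kills the ideal generated by the set.\<close>

lemma mccoy_ring_of_sum_closed:
  assumes nt: "\<one> \<noteq> \<zero>"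
    and sum: "\<And>f g. f \<in> zero_divisors P \<Longrightarrow> g \<in> zero_divisors P \<Longrightarrow> f \<oplus>\<^bsub>P\<^esub> g \<in> zero_divisors P"
  shows "mccoy_ring R"
proof -
  have enc: "\<exists>f \<in> zero_divisors P. S \<subseteq> range (up_coeff f)"
    if "finite S" "S \<subseteq> zero_divisors R" for S
    using that
  proof (induction S rule: finite_induct)
    case empty
    have "\<zero>\<^bsub>P\<^esub> \<in> zero_divisors P"
      unfolding zero_divisors_UP_iff using nt by (auto intro!: bexI[of _ \<one>])
    then show ?case by blast
  next
    case (insert s S)
    then obtain f where f: "f \<in> zero_divisors P" "S \<subseteq> range (up_coeff f)" by blast
    have fP: "f \<in> carrier P" and s: "s \<in> carrier R"
      using f insert.prems by (auto simp: zero_divisors_def)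
    define k where "k = Suc (deg R f)"
    define f' where "f' = f \<oplus>\<^bsub>P\<^esub> up_monom s k"
    have "f' \<in> zero_divisors P" unfolding f'_def
      using f insert.prems s by (intro sum) (simp_all add: monom_mem_zero_divisors_iff)
    moreover have c: "up_coeff f' n = up_coeff f n \<oplus> (if k = n then s else \<zero>)" for n
      using fP s by (simp add: f'_def)
    have fk: "up_coeff f n = \<zero>" if "k \<le> n" for n
      using that fP by (intro deg_aboveD) (auto simp: k_def)
    have "s = up_coeff f' k" using c[of k] fk[of k] s by simp
    moreover have "x \<in> range (up_coeff f')" if x: "x \<in> S" for x
    proof -
      obtain n where n: "x = up_coeff f n" using f x by blast
      \<comment> \<open>The only coefficient of \<open>f\<close> that is overwritten is the zero at \<open>k\<close>, which also occurs
        at \<open>Suc k\<close>.\<close>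
      have "x = up_coeff f' (if n = k then Suc k else n)"
        using n c fk[of k] fk[of "Suc k"] fP by simp
      then show ?thesis by blast
    qed
    ultimately show ?case by blast
  qed
  show ?thesis unfolding mccoy_ring_def
  proof (intro conjI allI impI)
    show "cring R" by (rule R.is_cring)
  next
    fix I assume "ideal I R \<and> (\<exists>S \<subseteq> carrier R. finite S \<and> I = Idl S) \<and> I \<subseteq> zero_divisors R"
    then obtain S where S: "S \<subseteq> carrier R" "finite S" "I = Idl S" and I: "I \<subseteq> zero_divisors R"
      by blast
    have "S \<subseteq> zero_divisors R" using R.genideal_self[OF S(1)] I S(3) by blast
    with enc S(2) obtain f where f: "f \<in> zero_divisors P" "S \<subseteq> range (up_coeff f)" by blast
    then obtain c where c: "c \<in> carrier R" "c \<noteq> \<zero>" "\<And>n. c \<otimes> up_coeff f n = \<zero>"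
      unfolding zero_divisors_UP_iff by blast
    have "S \<subseteq> R.annihilator c" using f(2) c(3) S(1) by (auto simp: R.annihilator_def)
    then have "I \<subseteq> R.annihilator c"
      unfolding S(3) by (intro R.genideal_minimal R.ideal_annihilator c(1))
    then show "\<exists>r \<in> carrier R. r \<noteq> \<zero> \<and> (\<forall>x \<in> I. r \<otimes> x = \<zero>)"
      using c(1,2) by (auto simp: R.annihilator_def)
  qed
qed

lemma diameter_UP_le_2_iff:
  assumes nt: "\<one> \<noteq> \<zero>"
  shows "graph_diameter (with_proj (zero_divisor_graph P)) \<le> 2 \<longleftrightarrow>
    subring_of_product_of_two_domains R \<or> mccoy_ring R \<and> ideal (zero_divisors R) R"
  unfolding R.subring_of_product_of_two_domains_iff
proof
  assume diam: "graph_diameter (with_proj (zero_divisor_graph P)) \<le> 2"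
  show "R.two_primes_meeting_in_zero \<or> mccoy_ring R \<and> ideal (zero_divisors R) R"
  proof (cases "P.two_primes_meeting_in_zero")
    case True
    then show ?thesis using two_primes_descend by blast
  next
    case False
    then have "f \<oplus>\<^bsub>P\<^esub> g \<in> zero_divisors P" if "f \<in> zero_divisors P" "g \<in> zero_divisors P" for f g
      using P.diameter_le_2_cases[OF diam that] by blast
    then show ?thesis
      using mccoy_ring_of_sum_closed[OF nt] zero_divisors_ideal_of_sum_closed[OF nt] by blast
  qed
next
  assume "R.two_primes_meeting_in_zero \<or> mccoy_ring R \<and> ideal (zero_divisors R) R"
  then show "graph_diameter (with_proj (zero_divisor_graph P)) \<le> 2"
    using two_primes_imp_diameter_UP_le_2 mccoy_imp_diameter_UP_le_2 by blast
qed

end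

theorem theorem3p3:
  fixes R :: "('a, 'm) ring_scheme"
  assumes "cring R" and "\<one>\<^bsub>R\<^esub> \<noteq> \<zero>\<^bsub>R\<^esub>" and "\<not> domain R"
  shows "(graph_diameter (with_proj (zero_divisor_graph (UP R))) = 1 \<longleftrightarrow>
            zero_divisors_square_zero R) \<and>
         (graph_diameter (with_proj (zero_divisor_graph (UP R))) = 2 \<longleftrightarrow>
            subring_of_product_of_two_domains R \<or>
            (mccoy_ring R \<and> ideal (zero_divisors R) R \<and> \<not> zero_divisors_square_zero R)) \<and>
         (graph_diameter (with_proj (zero_divisor_graph (UP R))) = 3 \<longleftrightarrow>
            (\<not> mccoy_ring R \<or> \<not> ideal (zero_divisors R) R) \<and>
            \<not> subring_of_product_of_two_domains R)"
proof -
  interpret UP_cring R "UP R" by (intro UP_cring.intro assms(1))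
  define d where "d = graph_diameter (with_proj (zero_divisor_graph (UP R)))"
  obtain x where x: "x \<in> zero_divisors R" "x \<noteq> \<zero>\<^bsub>R\<^esub>"
    using R.exists_nonzero_zero_divisor[OF assms(2,3)] .
  have "1 \<le> d" unfolding d_def by (rule diameter_UP_ge_1[OF assms(2,3)])
  moreover have "d \<le> 3" unfolding d_def by (rule P.zero_divisor_graph_diameter_le_3)
  moreover from this obtain n where n: "d = enat n" by (cases d) auto
  ultimately have "1 \<le> n" "n \<le> 3" by (simp_all add: one_enat_def numeral_eq_enat)
  then have d: "d = 1 \<longleftrightarrow> d \<le> 1" "d = 2 \<longleftrightarrow> d \<le> 2 \<and> \<not> d \<le> 1" "d = 3 \<longleftrightarrow> \<not> d \<le> 2"
    unfolding n one_enat_def numeral_eq_enat enat.inject enat_ord_simps by linarith+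
  have 1: "d \<le> 1 \<longleftrightarrow> zero_divisors_square_zero R"
    unfolding d_def by (rule diameter_UP_le_1_iff)
  have 2: "d \<le> 2 \<longleftrightarrow>
      subring_of_product_of_two_domains R \<or> mccoy_ring R \<and> ideal (zero_divisors R) R"
    unfolding d_def by (rule diameter_UP_le_2_iff[OF assms(2)])
  have 3: "subring_of_product_of_two_domains R \<Longrightarrow> \<not> zero_divisors_square_zero R"
    using R.two_primes_not_square_zero[OF _ x] R.subring_of_product_of_two_domains_iff by blast
  show ?thesis unfolding d_def[symmetric] d 1 2 using 3 by blast
qed

end
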